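(* Let $f:[0,\infty)\to\mathbb R$ be non-zero (i.e. $f\not\equiv 0$) and right continuous at some point of $[0,\infty)$, and let $g:[0,\infty)\to[0,\infty)$. Then $$f(s+g(s)t)=f(s)+f(t)\qquad\text{for all } s,t\in[0,\infty)$$ if and only if one of the following holds: 1. there is $a\in\mathbb R$, $a\neq 0$, such that $f(s)=as$ for all $s\in[0,\infty)$, and $g\equiv 1$; 2. there are $\alpha>0$ and $a\in\mathbb R$, $a\neq0$, such that $f(s)=a\log(\alpha s+1)$ and $g(s)=\alpha s+1$ for all $s\in[0,\infty)$. *)

theory Defs
  imports Complex_Main "HOL-Library.FuncSet"
begin

end

(* Write s o t = s + g(s) t. Comparing f(s o (t o u)) with f(t o (s o u)) shows that if
   s o t and t o s differ, their difference is an eventual period of f. Eventual periods are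
   stable under multiplication and division by the values of g, so if g is not constantly 1
   they become arbitrarily small, and right continuity makes f eventually constant, hence zero.
   So o is commutative; s o 1 = 1 o s reads g(s) = 1 + (g(1) - 1) s, and the substitution
   s = (exp x - 1) / \<alpha> (or the identity) turns f into an additive function. *)
theory Submission
  imports Defs
begin

section \<open>Small periods and additive functions\<close>

lemma period_multiple:
  fixes f :: "real \<Rightarrow> 'a"
  assumes "\<forall>x\<ge>p. f (x + d) = f x" "d \<ge> 0" "x \<ge> p"
  shows "f (x + real n * d) = f x"
proof (induction n)
  case (Suc n)
  have "f (x + real n * d + d) = f (x + real n * d)"
    using assms by (simp add: add_increasing2)
  with Suc show ?case by (simp add: algebra_simps)
qed simp

text \<open>Steps from \<open>x\<close> by a short enough period land in any given right
  neighbourhood of \<open>y\<close> without changing the value of \<open>f\<close>, so the right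
  limit at \<open>y\<close> must be \<open>f x\<close>.\<close>

lemma eq_if_small_periods:
  fixes f :: "real \<Rightarrow> real"
  assumes periods: "\<And>e. e > 0 \<Longrightarrow> \<exists>d. 0 < d \<and> d < e \<and> (\<forall>x\<ge>p. f (x + d) = f x)"
    and cont: "continuous (at_right y) f"
    and "p \<le> x" "x \<le> y"
  shows "f x = f y"
proof (rule ccontr)
  assume "f x \<noteq> f y"
  have "(f \<longlongrightarrow> f y) (at_right y)"
    using cont by (simp add: continuous_within)
  then have "eventually (\<lambda>z. f z \<noteq> f x) (at_right y)"
    using \<open>f x \<noteq> f y\<close> by (simp add: tendsto_imp_eventually_ne)
  then obtain b where b: "b > y" "\<And>z. y < z \<Longrightarrow> z < b \<Longrightarrow> f z \<noteq> f x"
    by (auto simp: eventually_at_right_field)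
  then obtain d where d: "0 < d" "d < b - y" "\<forall>x\<ge>p. f (x + d) = f x"
    using periods[of "b - y"] by auto
  have shift: "f (x + real n * d) = f x" for n
    using period_multiple[of p f d] d \<open>p \<le> x\<close> by simp
  \<comment> \<open>The \<open>+ 1\<close> pushes the point strictly past \<open>y\<close>, since
    the right limit ignores \<open>y\<close> itself; the overshoot is at most \<open>d\<close>,
    hence below \<open>b - y\<close>.\<close>
  define n where "n = nat \<lfloor>(y - x) / d\<rfloor> + 1"
  have n: "real n = of_int \<lfloor>(y - x) / d\<rfloor> + 1"
    unfolding n_def using d \<open>x \<le> y\<close> by simp
  have "(y - x) / d < real n" "real n \<le> (y - x) / d + 1"
    unfolding n by linarith+
  then have "y < x + real n * d" "x + real n * d \<le> y + d"
    using d by (simp_all add: field_simps)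
  with b(2)[of "x + real n * d"] d(2) shift show False by simp
qed

text \<open>Subtracting the linear candidate leaves an additive \<open>k\<close> with
  \<open>k 1 = 0\<close>. Then \<open>k\<close> vanishes at every \<open>1 / n\<close>, so these are
  arbitrarily small periods and \<open>k\<close> is constantly \<open>k 0 = 0\<close>.\<close>

lemma additive_right_continuous_imp_linear:
  fixes h :: "real \<Rightarrow> real"
  assumes add: "\<And>x y. 0 \<le> x \<Longrightarrow> 0 \<le> y \<Longrightarrow> h (x + y) = h x + h y"
    and lim: "(h \<longlongrightarrow> 0) (at_right 0)"
    and "0 \<le> x"
  shows "h x = h 1 * x"
proof -
  define k where "k = (\<lambda>x. h x - h 1 * x)"
  have k_add: "k (x + y) = k x + k y" if "0 \<le> x" "0 \<le> y" for x y
    using that by (simp add: k_def add algebra_simps)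
  have k_mult: "k (real n * x) = real n * k x" if "0 \<le> x" for n x
  proof (induction n)
    case 0
    show ?case using k_add[of 0 0] by simp
  next
    case (Suc n)
    then show ?case using k_add[of "real n * x" x] that by (simp add: algebra_simps)
  qed
  have "k 1 = 0" by (simp add: k_def)
  have "((\<lambda>z. h z - h 1 * z) \<longlongrightarrow> 0 - h 1 * 0) (at_right 0)"
    by (intro tendsto_intros lim)
  then have k_lim: "(k \<longlongrightarrow> 0) (at_right 0)" by (simp add: k_def)
  have k_cont: "continuous (at_right y) k" if "0 \<le> y" for y
  proof -
    have "((\<lambda>z. k (z - y)) \<longlongrightarrow> 0) (at_right y)"
      using k_lim by (simp add: at_right_to_0[of y] filterlim_filtermap)
    then have "((\<lambda>z. k y + k (z - y)) \<longlongrightarrow> k y + 0) (at_right y)"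
      by (intro tendsto_intros)
    moreover have "k y + k (z - y) = k z" if "y < z" for z
      using k_add[of y "z - y"] \<open>0 \<le> y\<close> that by simp
    then have "eventually (\<lambda>z. k y + k (z - y) = k z) (at_right y)"
      by (rule eventually_mono[OF eventually_at_right_less])
    ultimately have "(k \<longlongrightarrow> k y + 0) (at_right y)"
      by (rule Lim_transform_eventually)
    then show ?thesis by (simp add: continuous_within)
  qed
  have "k 0 = k x"
  proof (rule eq_if_small_periods[where f = k and p = 0])
    fix e :: real assume "e > 0"
    then obtain n where n: "inverse (real (Suc n)) < e"
      using reals_Archimedean by blast
    have "real (Suc n) * k (inverse (real (Suc n))) = 0"
      using k_mult[of "inverse (real (Suc n))" "Suc n"] \<open>k 1 = 0\<close> by simp
    then have "k (inverse (real (Suc n))) = 0" by (simp del: of_nat_Suc)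
    with n show "\<exists>d. 0 < d \<and> d < e \<and> (\<forall>x\<ge>0. k (x + d) = k x)"
      by (intro exI[of _ "inverse (real (Suc n))"]) (auto simp: k_add)
  qed (use \<open>0 \<le> x\<close> k_cont in auto)
  with k_mult[of 0 0] show ?thesis by (simp add: k_def)
qed

section \<open>Positivity of \<open>g\<close> and right continuity of \<open>f\<close>\<close>

locale goldie_equation =
  fixes f g :: "real \<Rightarrow> real"
  assumes f_nonzero: "\<exists>s\<ge>0. f s \<noteq> 0"
    and f_right_cont: "\<exists>x\<ge>0. continuous (at_right x) f"
    and g_nonneg: "s \<ge> 0 \<Longrightarrow> g s \<ge> 0"
    and eq: "s \<ge> 0 \<Longrightarrow> t \<ge> 0 \<Longrightarrow> f (s + g s * t) = f s + f t"
begin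

text \<open>If \<open>g s = 0\<close>, the equation reads \<open>f s = f s + f t\<close> for all
  \<open>t\<close>, so \<open>f\<close> vanishes.\<close>

lemma g_pos: "s \<ge> 0 \<Longrightarrow> g s > 0"
  using f_nonzero g_nonneg[of s] eq[of s] by (cases "g s = 0") auto

text \<open>With \<open>v\<close> as the second argument, \<open>f (x + g x * v)\<close> and
  \<open>f (y + g y * v)\<close> differ by a constant, so right continuity at \<open>x\<close>
  carries over to \<open>y\<close>.\<close>

lemma right_continuous:
  assumes "y \<ge> 0"
  shows "continuous (at_right y) f"
proof -
  obtain x where x: "x \<ge> 0" "(f \<longlongrightarrow> f x) (at_right x)"
    using f_right_cont by (auto simp: continuous_within)
  \<comment> \<open>The quotient is the \<open>v\<close> with
    \<open>y + g y * v = z\<close>.\<close>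
  let ?u = "\<lambda>z. x + g x * ((z - y) / g y)"
  note pos = g_pos[OF x(1)] g_pos[OF assms]
  have "(?u \<longlongrightarrow> ?u y) (at_right y)"
    using pos by (intro tendsto_intros) auto
  moreover have "eventually (\<lambda>z. ?u z \<in> {x<..}) (at_right y)"
    using pos by (auto simp: eventually_at_filter intro!: always_eventually)
  ultimately have "filterlim ?u (at_right x) (at_right y)"
    by (auto simp: filterlim_at elim: eventually_mono)
  with x(2) have "((\<lambda>z. f (?u z)) \<longlongrightarrow> f x) (at_right y)"
    by (rule filterlim_compose)
  then have "((\<lambda>z. f y - f x + f (?u z)) \<longlongrightarrow> f y - f x + f x) (at_right y)"
    by (intro tendsto_intros)
  moreover have "f y - f x + f (?u z) = f z" if "z > y" for z
    using eq[of x "(z - y) / g y"] eq[of y "(z - y) / g y"] that pos x(1) assms by simp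
  then have "eventually (\<lambda>z. f y - f x + f (?u z) = f z) (at_right y)"
    by (rule eventually_mono[OF eventually_at_right_less])
  ultimately have "(f \<longlongrightarrow> f y - f x + f x) (at_right y)"
    by (rule Lim_transform_eventually)
  then show ?thesis by (simp add: continuous_within)
qed

section \<open>Eventual periods and commutativity\<close>

text \<open>Such periods would make \<open>f\<close> constant from \<open>p\<close> on, and
  \<open>f (p + g p * t) = f p + f t\<close> would then give \<open>f t = 0\<close>.\<close>

lemma not_arbitrarily_small_periods:
  assumes "p \<ge> 0"
    and "\<And>e. e > 0 \<Longrightarrow> \<exists>d. 0 < d \<and> d < e \<and> (\<forall>x\<ge>p. f (x + d) = f x)"
  shows False
proof -
  have "f t = 0" if "t \<ge> 0" for t
  proof -
    have "0 \<le> g p * t" using that assms g_nonneg by simp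
    then have "f p = f (p + g p * t)"
      by (intro eq_if_small_periods[OF assms(2)] right_continuous) (use assms in auto)
    then show ?thesis using eq[of p t] that assms by simp
  qed
  with f_nonzero show False by auto
qed

text \<open>Shifting \<open>t\<close> by \<open>d\<close> shifts \<open>s + g s * t\<close> by
  \<open>g s * d\<close>; shifting it by \<open>d / g s\<close> shifts that point by
  \<open>d\<close>. Moving right by multiples of \<open>d\<close> first keeps the threshold at
  \<open>p\<close>, which allows iteration.\<close>

lemma period_scale:
  assumes "p \<ge> 0" "d > 0" and per: "\<forall>x\<ge>p. f (x + d) = f x" and "s \<ge> 0"
  shows "\<forall>x\<ge>p. f (x + g s * d) = f x" and "\<forall>x\<ge>p. f (x + d / g s) = f x"
proof -
  have c: "g s > 0" using g_pos \<open>s \<ge> 0\<close> .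
  have shift: "f (x + real n * d) = f x" if "x \<ge> p" for x n
    using period_multiple[of p f d] assms that by simp
  have far: "\<exists>n. z \<le> x + real n * d" for x z
    using reals_Archimedean3[OF \<open>d > 0\<close>] by (metis add.commute diff_le_eq less_imp_le)
  show "\<forall>x\<ge>p. f (x + g s * d) = f x"
  proof (intro allI impI)
    fix x assume x: "x \<ge> p"
    \<comment> \<open>Far enough right, the point has the form \<open>s + g s * t\<close> with
      \<open>t \<ge> p\<close>, where \<open>d\<close> is a period.\<close>
    obtain n where n: "s + g s * p \<le> x + real n * d" using far by blast
    define t where "t = (x + real n * d - s) / g s"
    have t: "t \<ge> p" "s + g s * t = x + real n * d"
      unfolding t_def using n c by (simp_all add: field_simps)
    have "x + g s * d \<ge> p" using x c assms by (simp add: add_increasing2)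
    then have "f (x + g s * d) = f (x + g s * d + real n * d)" using shift by simp
    also have "x + g s * d + real n * d = s + g s * (t + d)"
      using t(2) by (simp add: distrib_left)
    also have "f \<dots> = f (s + g s * t)"
      using eq[of s "t + d"] eq[of s t] t(1) assms by simp
    also have "\<dots> = f x" using t(2) shift x by simp
    finally show "f (x + g s * d) = f x" .
  qed
  show "\<forall>x\<ge>p. f (x + d / g s) = f x"
  proof (intro allI impI)
    fix x assume x: "x \<ge> p"
    obtain n where n: "p / g s \<le> x + real n * d" using far by blast
    let ?y = "x + real n * d"
    have y: "?y \<ge> 0" using x assms by simp
    have "p \<le> g s * ?y" using n c by (simp add: field_simps)
    then have p: "p \<le> s + g s * ?y" using assms by simp
    have "x + d / g s \<ge> p" using x c assms by (simp add: add_increasing2)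
    then have "f (x + d / g s) = f (x + d / g s + real n * d)" using shift by simp
    also have "x + d / g s + real n * d = ?y + d / g s" by simp
    also have "f \<dots> = f (s + g s * (?y + d / g s)) - f s"
      using eq[of s "?y + d / g s"] y c assms by simp
    also have "s + g s * (?y + d / g s) = s + g s * ?y + d"
      using c by (simp add: field_simps)
    also have "f \<dots> = f (s + g s * ?y)" using per p by blast
    also have "\<dots> - f s = f ?y" using eq[of s ?y] y assms by simp
    also have "\<dots> = f x" using shift x .
    finally show "f (x + d / g s) = f x" .
  qed
qed

text \<open>Otherwise \<open>g s\<close> or its inverse is a ratio \<open>r < 1\<close>, and the
  eventual periods \<open>r ^ n * d\<close> become arbitrarily small.\<close>

lemma period_imp_g_eq_1:
  assumes "p \<ge> 0" "d > 0" "\<forall>x\<ge>p. f (x + d) = f x" "s \<ge> 0"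
  shows "g s = 1"
proof (rule ccontr)
  assume "g s \<noteq> 1"
  have c: "g s > 0" using g_pos \<open>s \<ge> 0\<close> .
  define r where "r = (if g s < 1 then g s else 1 / g s)"
  have r: "0 < r" "r < 1" using c \<open>g s \<noteq> 1\<close> by (auto simp: r_def)
  have per: "\<forall>x\<ge>p. f (x + r ^ n * d) = f x" for n
  proof (induction n)
    case (Suc n)
    then show ?case
      using period_scale[of p "r ^ n * d" s] assms r
      by (cases "g s < 1") (auto simp: r_def mult.assoc)
  qed (use assms in simp)
  show False
  proof (rule not_arbitrarily_small_periods[OF \<open>p \<ge> 0\<close>])
    fix e :: real assume "e > 0"
    then obtain n where "r ^ n < e / d"
      using real_arch_pow_inv[of "e / d" r] r \<open>d > 0\<close> by auto
    then show "\<exists>d. 0 < d \<and> d < e \<and> (\<forall>x\<ge>p. f (x + d) = f x)"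
      using per[of n] r \<open>d > 0\<close>
      by (intro exI[of _ "r ^ n * d"]) (auto simp: field_simps)
  qed
qed

lemma commute:
  assumes "s \<ge> 0" "t \<ge> 0"
  shows "s + g s * t = t + g t * s"
proof -
  \<comment> \<open>By symmetry one inequality suffices; its failure makes the period
    \<open>q - p\<close> positive.\<close>
  have le: "t + g t * s \<le> s + g s * t" if st: "s \<ge> 0" "t \<ge> 0" for s t
  proof (rule ccontr)
    define p q where "p = s + g s * t" and "q = t + g t * s"
    assume "\<not> t + g t * s \<le> s + g s * t"
    then have "p < q" by (simp add: p_def q_def)
    have "p \<ge> 0" using st g_nonneg by (simp add: p_def)
    have pos: "g s > 0" "g t > 0" using g_pos st by auto
    have "f (x + (q - p)) = f x" if "x \<ge> p" for x
    proof -
      \<comment> \<open>Both nestings scale \<open>u\<close> by \<open>g s * g t\<close>: they give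
        \<open>p + g s * g t * u\<close> and \<open>q + g s * g t * u\<close>, and \<open>f\<close>
        takes the value \<open>f s + f t + f u\<close> at each.\<close>
      define u where "u = (x - p) / (g s * g t)"
      have u: "u \<ge> 0" "x = p + g s * g t * u"
        unfolding u_def using that pos by simp_all
      have "f x = f (s + g s * (t + g t * u))"
        unfolding u(2) p_def by (simp add: algebra_simps)
      also have "\<dots> = f s + (f t + f u)" using u(1) st pos by (simp add: eq)
      also have "\<dots> = f (t + g t * (s + g s * u))" using u(1) st pos by (simp add: eq)
      also have "\<dots> = f (x + (q - p))"
        unfolding u(2) q_def by (simp add: algebra_simps)
      finally show ?thesis ..
    qed
    then have "g z = 1" if "z \<ge> 0" for z
      using period_imp_g_eq_1[of p "q - p"] \<open>p \<ge> 0\<close> \<open>p < q\<close> that by simp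
    then show False using \<open>p < q\<close> st by (simp add: p_def q_def)
  qed
  show ?thesis using le[of s t] le[of t s] assms by simp
qed

section \<open>Explicit form of \<open>g\<close> and \<open>f\<close>\<close>

text \<open>Commuting \<open>s\<close> with 1 determines \<open>g\<close>. A negative slope would
  give \<open>g\<close> a zero at \<open>1 / (1 - g 1)\<close>, against positivity.\<close>

lemma g_affine:
  obtains \<alpha> where "\<alpha> \<ge> 0" "\<And>s. s \<ge> 0 \<Longrightarrow> g s = \<alpha> * s + 1"
proof
  show affine: "g s = (g 1 - 1) * s + 1" if "s \<ge> 0" for s
    using commute[of 1 s] that by (simp add: algebra_simps)
  show "g 1 - 1 \<ge> 0"
  proof (rule ccontr)
    assume "\<not> g 1 - 1 \<ge> 0"
    then show False
      using affine[of "1 / (1 - g 1)"] g_pos[of "1 / (1 - g 1)"] by (simp add: field_simps)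
  qed
qed

lemma f_0: "f 0 = 0"
  using eq[of 0 0] by simp

lemma f_tendsto_0: "(f \<longlongrightarrow> 0) (at_right 0)"
  using right_continuous[of 0] by (simp add: continuous_within f_0)

lemma solution:
  "(\<exists>a. a \<noteq> 0 \<and> (\<forall>s\<in>{0..}. f s = a * s) \<and> (\<forall>s\<in>{0..}. g s = 1)) \<or>
   (\<exists>\<alpha> a. \<alpha> > 0 \<and> a \<noteq> 0 \<and> (\<forall>s\<in>{0..}. f s = a * ln (\<alpha> * s + 1) \<and> g s = \<alpha> * s + 1))"
proof -
  obtain \<alpha> where \<alpha>: "\<alpha> \<ge> 0" "\<And>s. s \<ge> 0 \<Longrightarrow> g s = \<alpha> * s + 1"
    by (rule g_affine) blast
  show ?thesis
  proof (cases "\<alpha> = 0")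
    case True
    have "f (s + t) = f s + f t" if "s \<ge> 0" "t \<ge> 0" for s t
      using eq[of s t] that \<alpha>(2) True by simp
    then have lin: "f s = f 1 * s" if "s \<ge> 0" for s
      using additive_right_continuous_imp_linear f_tendsto_0 that by blast
    then have "f 1 \<noteq> 0" using f_nonzero by (metis mult_zero_left)
    then show ?thesis using lin \<alpha>(2) True by (metis atLeast_iff add_0 mult_zero_left)
  next
    case False
    with \<alpha>(1) have "\<alpha> > 0" by simp
    \<comment> \<open>The inverse of \<open>ln (\<alpha> * s + 1)\<close>; it turns addition into
      the operation \<open>s + g s * t\<close>, so \<open>f (u x)\<close> is additive in
      \<open>x\<close>.\<close>
    define u where "u = (\<lambda>x. (exp x - 1) / \<alpha>)"
    have u_nonneg: "u x \<ge> 0" if "x \<ge> 0" for x using that \<open>\<alpha> > 0\<close> by (simp add: u_def)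
    have u_add: "u (x + y) = u x + (\<alpha> * u x + 1) * u y" for x y
      using \<open>\<alpha> > 0\<close> by (simp add: u_def exp_add field_simps)
    have "(u \<longlongrightarrow> u 0) (at_right 0)"
      unfolding u_def by (intro tendsto_intros) (use \<open>\<alpha> > 0\<close> in auto)
    \<comment> \<open>Positivity of \<open>u\<close> to the right of 0 lets the one-sided limit of
      \<open>f\<close> pass through the substitution.\<close>
    moreover have "eventually (\<lambda>x. u x \<in> {0<..}) (at_right 0)"
      using \<open>\<alpha> > 0\<close> by (auto simp: u_def eventually_at_filter intro!: always_eventually)
    ultimately have "filterlim u (at_right 0) (at_right 0)"
      by (auto simp: filterlim_at u_def elim: eventually_mono)
    with f_tendsto_0 have lim: "((\<lambda>x. f (u x)) \<longlongrightarrow> 0) (at_right 0)"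
      by (rule filterlim_compose)
    have add: "f (u (x + y)) = f (u x) + f (u y)" if "0 \<le> x" "0 \<le> y" for x y
      using eq[of "u x" "u y"] \<alpha>(2)[of "u x"] u_nonneg that by (simp add: u_add)
    have lin: "f (u x) = f (u 1) * x" if "0 \<le> x" for x
      using additive_right_continuous_imp_linear[of "\<lambda>x. f (u x)"] add lim that by blast
    have f: "f s = f (u 1) * ln (\<alpha> * s + 1)" if "s \<ge> 0" for s
    proof -
      have "\<alpha> * s \<ge> 0" using that \<open>\<alpha> > 0\<close> by simp
      then have "u (ln (\<alpha> * s + 1)) = s" using \<open>\<alpha> > 0\<close> by (simp add: u_def)
      with lin[of "ln (\<alpha> * s + 1)"] \<open>\<alpha> * s \<ge> 0\<close> show ?thesis by simp
    qed
    then have "f (u 1) \<noteq> 0" using f_nonzero by (metis mult_zero_left)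
    with f \<alpha>(2) \<open>\<alpha> > 0\<close> show ?thesis
      by (intro disjI2 exI[of _ \<alpha>] exI[of _ "f (u 1)"]) auto
  qed
qed

end

theorem theorem3p3:
  fixes f g :: "real \<Rightarrow> real"
  assumes f_nonzero: "\<exists>s\<in>{0..}. f s \<noteq> 0"
    and f_right_cont: "\<exists>x\<in>{0..}. continuous (at_right x) f"
    and g_nonneg: "g \<in> {0..} \<rightarrow> {0..}"
  shows "(\<forall>s\<in>{0..}. \<forall>t\<in>{0..}. f (s + g s * t) = f s + f t) \<longleftrightarrow>
    ((\<exists>a. a \<noteq> 0 \<and> (\<forall>s\<in>{0..}. f s = a * s) \<and> (\<forall>s\<in>{0..}. g s = 1)) \<or>
     (\<exists>\<alpha> a. \<alpha> > 0 \<and> a \<noteq> 0 \<and>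
        (\<forall>s\<in>{0..}. f s = a * ln (\<alpha> * s + 1) \<and> g s = \<alpha> * s + 1)))"
    (is "?eq \<longleftrightarrow> ?linear \<or> ?log")
proof
  assume ?eq
  then interpret goldie_equation f g
    using assms by unfold_locales auto
  show "?linear \<or> ?log" by (rule solution)
next
  assume "?linear \<or> ?log"
  then show ?eq
  proof
    assume ?linear
    then show ?thesis by (auto simp: algebra_simps)
  next
    assume ?log
    then obtain \<alpha> a where \<alpha>: "\<alpha> > 0"
      and fg: "\<And>s. s \<ge> 0 \<Longrightarrow> f s = a * ln (\<alpha> * s + 1)" "\<And>s. s \<ge> 0 \<Longrightarrow> g s = \<alpha> * s + 1"
      by auto
    show ?thesis
    proof (intro ballI)
      fix s t :: real assume "s \<in> {0..}" "t \<in> {0..}"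
      then have st: "s \<ge> 0" "t \<ge> 0" by auto
      then have pos: "\<alpha> * s + 1 > 0" "\<alpha> * t + 1 > 0"
        using \<alpha> by (auto intro: add_nonneg_pos)
      have "f (s + g s * t) = a * ln (\<alpha> * (s + (\<alpha> * s + 1) * t) + 1)"
        using fg st pos by simp
      \<comment> \<open>The map sending \<open>s\<close> to \<open>\<alpha> * s + 1\<close> turns
        the operation into multiplication, which \<open>ln\<close> turns into a sum.\<close>
      also have "\<alpha> * (s + (\<alpha> * s + 1) * t) + 1 = (\<alpha> * s + 1) * (\<alpha> * t + 1)"
        by (simp add: algebra_simps)
      also have "a * ln \<dots> = f s + f t"
        by (simp only: ln_mult_pos[OF pos] distrib_left[of a] fg(1)[OF st(1)] fg(1)[OF st(2)])
      finally show "f (s + g s * t) = f s + f t" .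
    qed
  qed
qed

end
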